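(* Let $\mathbb{F}=\mathbb{F}_q$ be a finite field with $q$ elements. The number of isomorphism classes of two-dimensional algebras $A$ over $\mathbb{F}$ for which at least one of the two trace vectors $tr_1(A)$, $tr_2(A)$ is non-zero equals: \begin{itemize} \item $q^4+q^3+4q^2+4q+1$ if $\mathrm{char}(\mathbb{F})\neq 2,3$; \item $q^4+q^3+4q^2+4q$ if $\mathrm{char}(\mathbb{F})=3$; \item $q^4+q^3+4q^2+3q$ if $\mathrm{char}(\mathbb{F})=2$. \end{itemize}
   Context: A two-dimensional algebra over $\mathbb{F}$ is a two-dimensional $\mathbb{F}$-vector space with an arbitrary $\mathbb{F}$-bilinear multiplication (no associativity, commutativity or unit is assumed); isomorphisms are $\mathbb{F}$-linear bijections preserving multiplication. In a basis $e_1,e_2$ the algebra is given by its matrix of structure constants \[A=\begin{pmatrix}\alpha_1&\alpha_2&\alpha_3&\alpha_4\\ \beta_1&\beta_2&\beta_3&\beta_4\end{pmatrix},\] meaning $e_1e_1=\alpha_1e_1+\beta_1e_2$, $e_1e_2=\alpha_2e_1+\beta_2e_2$, $e_2e_1=\alpha_3e_1+\beta_3e_2$, $e_2e_2=\alpha_4e_1+\beta_4e_2$. The traces of $A$ are the vectors $tr_1(A)=(\alpha_1+\beta_3,\ \alpha_2+\beta_4)$ and $tr_2(A)=(\alpha_1+\beta_2,\ \alpha_3+\beta_4)$ in $\mathbb{F}^2$. Under a change of basis $e'=eg^{-1}$, $g\in GL_2(\mathbb{F})$, one has $A'=gA(g^{-1}\otimes g^{-1})$ and $tr_i(A')=tr_i(A)g^{-1}$,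 so whether $tr_i$ vanishes does not depend on the basis. *)

theory Defs
  imports "HOL-Analysis.Analysis"
begin

definition two_dim_algebra ::
    "('a::field \<Rightarrow> 'v::ab_group_add \<Rightarrow> 'v) \<Rightarrow> ('v \<Rightarrow> 'v \<Rightarrow> 'v) \<Rightarrow> bool" where
  "two_dim_algebra sc mul \<longleftrightarrow>
     vector_space sc \<and> vector_space.dim sc UNIV = 2 \<and>
     (\<forall>x. Vector_Spaces.linear sc sc (\<lambda>y. mul x y)) \<and>
     (\<forall>y. Vector_Spaces.linear sc sc (\<lambda>x. mul x y))"

definition algebra_isomorphic ::
    "('a::field \<Rightarrow> 'v::ab_group_add \<Rightarrow> 'v) \<Rightarrow> ('v \<Rightarrow> 'v \<Rightarrow> 'v) \<Rightarrow>
     ('a \<Rightarrow> 'w::ab_group_add \<Rightarrow> 'w) \<Rightarrow> ('w \<Rightarrow> 'w \<Rightarrow> 'w) \<Rightarrow> bool" where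
  "algebra_isomorphic sc mul sc' mul' \<longleftrightarrow>
     (\<exists>f. Vector_Spaces.linear sc sc' f \<and> bij f \<and>
          (\<forall>x y. f (mul x y) = mul' (f x) (f y)))"

text \<open>
  Isomorphism classes are counted on the single underlying space \<open>F^2\<close>. The lemma
  \<open>two_dim_algebra_representative\<close> below shows that every two-dimensional algebra
  is isomorphic to one on \<open>F^2\<close>, for which moreover a prescribed basis \<open>b1, b2\<close>
  corresponds to the standard basis, so that both have the same structure constants.
\<close>

definition algebra_iso_rel ::
    "(('a::field^2 \<Rightarrow> 'a^2 \<Rightarrow> 'a^2) \<times> ('a^2 \<Rightarrow> 'a^2 \<Rightarrow> 'a^2)) set" where
  "algebra_iso_rel =
     {(m, m'). two_dim_algebra (*s) m \<and> two_dim_algebra (*s) m' \<and>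
               algebra_isomorphic (*s) m (*s) m'}"

definition structure_matrix :: "('a::field^2 \<Rightarrow> 'a^2 \<Rightarrow> 'a^2) \<Rightarrow> 'a^4^2" where
  "structure_matrix m =
     (let e1 = axis 1 1; e2 = axis 2 1 in
      vector [vector [m e1 e1 $ 1, m e1 e2 $ 1, m e2 e1 $ 1, m e2 e2 $ 1],
              vector [m e1 e1 $ 2, m e1 e2 $ 2, m e2 e1 $ 2, m e2 e2 $ 2]])"

text \<open>With \<open>\<alpha>\<^sub>j = A $ 1 $ j\<close> and \<open>\<beta>\<^sub>j = A $ 2 $ j\<close>:\<close>

definition tr1 :: "'a::field^4^2 \<Rightarrow> 'a^2" where
  "tr1 A = vector [A $ 1 $ 1 + A $ 2 $ 3, A $ 1 $ 2 + A $ 2 $ 4]"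

definition tr2 :: "'a::field^4^2 \<Rightarrow> 'a^2" where
  "tr2 A = vector [A $ 1 $ 1 + A $ 2 $ 2, A $ 1 $ 3 + A $ 2 $ 4]"

lemma structure_matrix_nth:
  "structure_matrix m $ 1 $ 1 = m (axis 1 1) (axis 1 1) $ 1"
  "structure_matrix m $ 1 $ 2 = m (axis 1 1) (axis 2 1) $ 1"
  "structure_matrix m $ 1 $ 3 = m (axis 2 1) (axis 1 1) $ 1"
  "structure_matrix m $ 1 $ 4 = m (axis 2 1) (axis 2 1) $ 1"
  "structure_matrix m $ 2 $ 1 = m (axis 1 1) (axis 1 1) $ 2"
  "structure_matrix m $ 2 $ 2 = m (axis 1 1) (axis 2 1) $ 2"
  "structure_matrix m $ 2 $ 3 = m (axis 2 1) (axis 1 1) $ 2"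
  "structure_matrix m $ 2 $ 4 = m (axis 2 1) (axis 2 1) $ 2"
  by (simp_all add: structure_matrix_def Let_def vector_def)

lemma linear_mapI:
  assumes "vector_space s" "vector_space t"
    and "\<And>x y. f (x + y) = f x + f y" "\<And>c x. f (s c x) = t c (f x)"
  shows "Vector_Spaces.linear s t f"
  using assms
  by (simp add: module_hom_iff_linear[symmetric] module_hom_def module_hom_axioms_def
      module_iff_vector_space)

lemma linear_mapD:
  assumes "Vector_Spaces.linear s t f"
  shows "f (x + y) = f x + f y" "f (s c x) = t c (f x)"
  using assms unfolding module_hom_iff_linear[symmetric]
  by (simp_all add: module_hom_def module_hom_axioms_def)

lemma vector_space_vec: "vector_space ((*s) :: 'a::field \<Rightarrow> 'a^'n \<Rightarrow> 'a^'n)"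
  by unfold_locales

lemma vec_dim_2: "vector_space.dim (*s) (UNIV :: ('a::field^2) set) = 2"
  unfolding vec_dim_card by simp

lemma two_dim_algebra_representative:
  fixes sc :: "'a::field \<Rightarrow> 'v::ab_group_add \<Rightarrow> 'v"
  assumes alg: "two_dim_algebra sc mul"
    and basis: "b1 \<noteq> b2" "\<not> module.dependent sc {b1, b2}"
      "module.span sc {b1, b2} = UNIV"
  obtains m :: "'a^2 \<Rightarrow> 'a^2 \<Rightarrow> 'a^2" and h :: "'a^2 \<Rightarrow> 'v"
  where "two_dim_algebra (*s) m"
    and "Vector_Spaces.linear (*s) sc h" "bij h" "\<And>x y. h (m x y) = mul (h x) (h y)"
    and "h (axis 1 1) = b1" "h (axis 2 1) = b2"
    and "algebra_isomorphic (*s) m sc mul"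
proof -
  have vs: "vector_space sc"
    and lr: "\<And>x. Vector_Spaces.linear sc sc (\<lambda>y. mul x y)"
    and ll: "\<And>y. Vector_Spaces.linear sc sc (\<lambda>x. mul x y)"
    using alg by (auto simp: two_dim_algebra_def)
  interpret V: vector_space sc by (fact vs)
  define h where "h = (\<lambda>x::'a^2. sc (x $ 1) b1 + sc (x $ 2) b2)"
  have h_add: "h (x + y) = h x + h y" for x y
    by (simp only: h_def V.scale_left_distrib vector_add_component ac_simps)
  have h_sc: "h (c *s x) = sc c (h x)" for c x
    by (simp only: h_def V.scale_right_distrib V.scale_scale vector_smult_component)
  have hlin: "Vector_Spaces.linear (*s) sc h"
    by (rule linear_mapI) (rule vector_space_vec vs h_add h_sc)+
  have ker: "x = 0" if "h x = 0" for x
  proof -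
    define u where "u = (\<lambda>v. if v = b1 then x $ 1 else x $ 2)"
    have s0: "(\<Sum>v\<in>{b1,b2}. sc (u v) v) = 0"
      using that basis(1) by (auto simp: u_def h_def)
    have u0: "u v = 0" if "v \<in> {b1,b2}" for v
      using V.independentD[OF basis(2) _ subset_refl s0 that] by simp
    have "x $ 1 = 0" "x $ 2 = 0" using u0[of b1] u0[of b2] basis(1) by (auto simp: u_def)
    then show ?thesis by (simp add: vec_eq_iff forall_2)
  qed
  have "inj h"
  proof (rule injI)
    fix x y assume "h x = h y"
    moreover have "h x = h (x - y) + h y" using h_add[of "x - y" y] by simp
    ultimately have "h (x - y) = 0" by simp
    from ker[OF this] show "x = y" by simp
  qed
  moreover have "surj h"
  proof -
    have "\<exists>x. v = h x" for v
    proof -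
      have "v \<in> V.span {b1,b2}" using basis(3) by simp
      then obtain k where "v - sc k b1 \<in> V.span {b2}" by (auto simp: V.span_insert)
      then obtain l where "v - sc k b1 = sc l b2" by (auto simp: V.span_singleton)
      then have "v = sc l b2 + sc k b1" by (metis diff_add_cancel)
      also have "\<dots> = h (vector [k, l])" by (simp add: h_def add.commute)
      finally have "v = h (vector [k, l])" .
      then show ?thesis by blast
    qed
    then show ?thesis by (auto simp: surj_def)
  qed
  ultimately have "bij h" by (simp add: bij_def)
  define g where "g = inv h"
  have hg: "h (g v) = v" for v using \<open>surj h\<close> by (simp add: g_def surj_f_inv_f)
  define m where "m = (\<lambda>x y. g (mul (h x) (h y)))"
  have hm: "h (m x y) = mul (h x) (h y)" for x y by (simp add: m_def hg)
  have hI: "x = y" if "h x = h y" for x y using \<open>inj h\<close> that by (simp add: inj_eq)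
  have "two_dim_algebra (*s) m"
    unfolding two_dim_algebra_def
  proof (intro conjI allI vec_dim_2 vector_space_vec)
    fix x
    note R = linear_mapD[where f = "\<lambda>y. mul u y" for u, OF lr]
      and L = linear_mapD[where f = "\<lambda>y. mul y u" for u, OF ll]
    show "Vector_Spaces.linear (*s) (*s) (\<lambda>y. m x y)"
      by (rule linear_mapI, rule vector_space_vec, rule vector_space_vec; rule hI)
        (simp_all only: hm h_add h_sc R)
    show "Vector_Spaces.linear (*s) (*s) (\<lambda>y. m y x)"
      by (rule linear_mapI, rule vector_space_vec, rule vector_space_vec; rule hI)
        (simp_all only: hm h_add h_sc L)
  qed
  moreover have "h (axis 1 1) = b1" "h (axis 2 1) = b2" by (simp_all add: h_def axis_def)
  moreover have "algebra_isomorphic (*s) m sc mul"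
    unfolding algebra_isomorphic_def using hlin \<open>bij h\<close> hm by blast
  ultimately show ?thesis using that hlin \<open>bij h\<close> hm by blast
qed

end

theory Submission
  imports Defs
begin

text \<open>
  The pair of trace functionals is carried along by isomorphisms, so every isomorphism class meets
  exactly one of the following families, on which only the stabiliser of the traces acts. If the
  traces are linearly independent, they can be normalised to the standard dual basis; the
  stabiliser is then trivial and each of the \<open>q^4\<close> algebras is its own class. Otherwise they can be
  normalised to \<open>(s, 0)\<close> and \<open>(t, 0)\<close> with \<open>(s : t)\<close> one of the \<open>q + 1\<close> points of the projective line.
  The stabiliser consists of the \<open>q (q - 1)\<close> substitutions \<open>e\<^sub>1' = e\<^sub>1 + u e\<^sub>2\<close>, \<open>e\<^sub>2' = v e\<^sub>2\<close>, and its
  action on the four remaining structure constants depends only on \<open>s + t\<close>. Counting fixed points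
  (Burnside) gives \<open>q^2 + 3 q + 1\<close> orbits in characteristic other than 2 and 3, \<open>q^2 + 3 q\<close> in
  characteristic 2, and in characteristic 3 either \<open>q^2 + 4 q\<close> or \<open>q^2 + 3 q\<close> according as
  \<open>s + t = 0\<close> or not; \<open>s + t = 0\<close> happens for exactly one point \<open>(s : t)\<close>.
\<close>

subsection \<open>Counting orbits\<close>

text \<open>Burnside's lemma, with the orbits given as the fibres of \<open>f\<close>. Pairs of a
  group element and a point fixed by it are counted in two ways. Within one fibre, right translation
  matches each stabiliser with the set of elements carrying a base point \<open>y\<close> to
  \<open>x\<close>, and these sets partition \<open>G\<close>.\<close>

lemma card_image_orbits:
  fixes act :: "'g \<Rightarrow> 'x \<Rightarrow> 'x" and mul :: "'g \<Rightarrow> 'g \<Rightarrow> 'g"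
  assumes fin: "finite G" "finite X"
    and closed: "\<And>g x. g \<in> G \<Longrightarrow> x \<in> X \<Longrightarrow> act g x \<in> X"
    and act_mul: "\<And>g h x. g \<in> G \<Longrightarrow> h \<in> G \<Longrightarrow> x \<in> X \<Longrightarrow> act (mul g h) x = act g (act h x)"
    and bij: "\<And>h. h \<in> G \<Longrightarrow> bij_betw (\<lambda>g. mul g h) G G"
    and orb: "\<And>x y. x \<in> X \<Longrightarrow> y \<in> X \<Longrightarrow> f x = f y \<longleftrightarrow> (\<exists>g\<in>G. act g y = x)"
  shows "card (f ` X) * card G = (\<Sum>g\<in>G. card {x\<in>X. act g x = x})"
proof -
  have stab: "card {g\<in>G. act g x = x} = card {g\<in>G. act g y = x}"
    if xy: "x \<in> X" "y \<in> X" and fxy: "f x = f y" for x y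
  proof -
    obtain h where h: "h \<in> G" "act h y = x" using orb[OF xy] fxy by auto
    have inj: "inj_on (\<lambda>g. mul g h) G" and im: "(\<lambda>g. mul g h) ` G = G"
      using bij[OF h(1)] by (auto simp: bij_betw_def)
    have "(\<lambda>g. mul g h) ` {g\<in>G. act g x = x} = {g\<in>G. act g y = x}" (is "?L = ?R")
    proof
      show "?L \<subseteq> ?R" using im act_mul h xy by force
      show "?R \<subseteq> ?L"
      proof
        fix k assume k: "k \<in> ?R"
        then obtain g where "g \<in> G" "k = mul g h" using im by blast
        then show "k \<in> ?L" using k act_mul[OF _ h(1) xy(2)] h by auto
      qed
    qed
    moreover have "inj_on (\<lambda>g. mul g h) {g\<in>G. act g x = x}"
      using inj by (rule inj_on_subset) auto
    ultimately show ?thesis using card_image[of "\<lambda>g. mul g h" "{g\<in>G. act g x = x}"] by simp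
  qed
  have orbit: "(\<Sum>x\<in>{x\<in>X. f x = f y}. card {g\<in>G. act g x = x}) = card G"
    if y: "y \<in> X" for y
  proof -
    have "(\<Sum>x\<in>{x\<in>X. f x = f y}. card {g\<in>G. act g x = x})
        = (\<Sum>x\<in>{x\<in>X. f x = f y}. card {g\<in>G. act g y = x})"
      using stab y by (intro sum.cong) auto
    also have "\<dots> = card (\<Union>x\<in>{x\<in>X. f x = f y}. {g\<in>G. act g y = x})"
      using fin by (intro card_UN_disjoint[symmetric]) auto
    also have "(\<Union>x\<in>{x\<in>X. f x = f y}. {g\<in>G. act g y = x}) = G"
      using orb[OF _ y] closed[OF _ y] by auto
    finally show ?thesis .
  qed
  have "(\<Sum>g\<in>G. card {x\<in>X. act g x = x}) = (\<Sum>g\<in>G. \<Sum>x\<in>X. if act g x = x then 1 else 0)"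
    using fin by (simp add: sum.If_cases Int_def)
  also have "\<dots> = (\<Sum>x\<in>X. \<Sum>g\<in>G. if act g x = x then 1 else 0)"
    by (rule sum.swap)
  also have "\<dots> = (\<Sum>x\<in>X. card {g\<in>G. act g x = x})"
    using fin by (simp add: sum.If_cases Int_def)
  also have "\<dots> = (\<Sum>c\<in>f ` X. \<Sum>x\<in>{x\<in>X. f x = c}. card {g\<in>G. act g x = x})"
    using fin(2) by (rule sum.image_gen)
  also have "\<dots> = (\<Sum>c\<in>f ` X. card G)"
    using orbit by (intro sum.cong) auto
  finally show ?thesis by simp
qed

text \<open>
  Effect of \<open>e\<^sub>1' = e\<^sub>1 + u e\<^sub>2\<close>, \<open>e\<^sub>2' = v e\<^sub>2\<close> on the constants \<open>(\<alpha>\<^sub>1, \<alpha>\<^sub>2, \<alpha>\<^sub>4, \<beta>\<^sub>1)\<close> of an algebra with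
  trace vectors \<open>(s, 0)\<close> and \<open>(t, 0)\<close>, where \<open>r = s + t\<close>.
\<close>

fun shift :: "'a::field \<Rightarrow> 'a \<times> 'a \<Rightarrow> 'a \<times> 'a \<times> 'a \<times> 'a \<Rightarrow> 'a \<times> 'a \<times> 'a \<times> 'a" where
  "shift r (u, v) (a, b, c, d) =
     (a + 2 * u * b + u^2 * c, v * (b + u * c), v^2 * c,
      (d + u * r - 3 * u * a - 3 * u^2 * b - u^3 * c) / v)"

text \<open>With \<open>(u, v)\<close> standing for the matrix with rows (1, 0) and (u, v), this is
  the matrix product in reverse order: \<open>shift\<close> pulls structure constants back along a
  linear map, and pulling back reverses composition.\<close>

definition shift_mul :: "'a::field \<times> 'a \<Rightarrow> 'a \<times> 'a \<Rightarrow> 'a \<times> 'a" where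
  "shift_mul g h = (fst h + snd h * fst g, snd g * snd h)"

lemma shift_shift_mul:
  assumes "v \<noteq> 0" "v' \<noteq> 0"
  shows "shift r (shift_mul (u, v) (u', v')) p = shift r (u, v) (shift r (u', v') p)"
proof (cases p)
  case (fields a b c d)
  show ?thesis unfolding fields shift_mul_def using assms
    by (simp add: field_simps power2_eq_square power3_eq_cube)
qed

lemma bij_shift_mul:
  assumes "w \<noteq> 0"
  shows "bij_betw (\<lambda>g. shift_mul g (u, w)) (UNIV \<times> - {0}) (UNIV \<times> - {0})"
  by (rule bij_betw_byWitness[where f' = "\<lambda>g. ((fst g - u) / w, snd g / w)"])
     (use assms in \<open>auto simp: shift_mul_def\<close>)

section \<open>Fixed points of a single substitution\<close>

abbreviation shift_fixed :: "'a::field \<Rightarrow> 'a \<Rightarrow> 'a \<Rightarrow> ('a \<times> 'a \<times> 'a \<times> 'a) set" where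
  "shift_fixed r u v \<equiv> {p. shift r (u, v) p = p}"

text \<open>Since v and v^2 differ from 1, the third and second coordinates force c = 0 and b = 0.
  The first is then automatic, and the last determines d because v - 1 is invertible, so only a is
  free.\<close>

lemma card_fixed_generic:
  fixes v :: "'a::{field,finite}"
  assumes "v \<noteq> 0" "v^2 \<noteq> 1"
  shows "card (shift_fixed r u v) = CARD('a)"
proof -
  have v1: "v \<noteq> 1" using assms by auto
  have *: "shift r (u, v) (a, b, c, d) = (a, b, c, d) \<longleftrightarrow>
      b = 0 \<and> c = 0 \<and> d = (u * r - 3 * u * a) / (v - 1)" for a b c d
  proof -
    have "v^2 * c = c \<longleftrightarrow> c = 0" using assms by (metis mult_cancel_right1)
    moreover have "v * b = b \<longleftrightarrow> b = 0" using v1 by (metis mult_cancel_right1)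
    moreover have "(d + u * r - 3 * u * a) / v = d \<longleftrightarrow> d = (u * r - 3 * u * a) / (v - 1)"
      using v1 assms by (auto simp: field_simps)
    ultimately show ?thesis by auto
  qed
  have "shift_fixed r u v = (\<lambda>a. (a, 0, 0, (u * r - 3 * u * a) / (v - 1))) ` UNIV"
    by (auto simp del: shift.simps simp: * image_iff)
  then show ?thesis by (simp add: card_image inj_on_def)
qed

text \<open>The third coordinate is automatic and the second gives b = -uc/2, which makes the first
  automatic as well. The last determines d, again by halving, so a and c are free.\<close>

lemma card_fixed_minus_one:
  assumes "(2::'a::{field,finite}) \<noteq> 0"
  shows "card (shift_fixed r u (-1::'a)) = CARD('a)^2"
proof -
  define B where "B = (\<lambda>c. - u * c / 2)"
  define D where "D = (\<lambda>a b c. - (u * r - 3 * u * a - 3 * u^2 * b - u^3 * c) / 2)"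
  have half: "- (x + y) = x \<longleftrightarrow> x = - y / 2" for x y :: 'a
  proof -
    have "- (x + y) = x \<longleftrightarrow> 2 * x = - y"
      by (metis add_diff_cancel_right' minus_add_distrib mult_2 uminus_add_conv_diff)
    then show ?thesis using assms by (auto simp: field_simps)
  qed
  have *: "shift r (u, -1) (a, b, c, d) = (a, b, c, d) \<longleftrightarrow> b = B c \<and> d = D a b c"
    for a b c d :: 'a
  proof -
    have "a + 2 * u * b + u^2 * c = a" if "b = - u * c / 2"
      using assms by (simp add: that power2_eq_square)
    then show ?thesis
      using half[of b "u * c"] half[of d "u * r - 3 * u * a - 3 * u^2 * b - u^3 * c"]
      by (auto simp: B_def D_def algebra_simps)
  qed
  have "shift_fixed r u (-1) = (\<lambda>(a, c). (a, B c, c, D a (B c) c)) ` UNIV"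
    by (auto simp del: shift.simps simp: * image_iff)
  then show ?thesis
    by (subst \<open>shift_fixed r u (-1) = _\<close>, subst card_image) (auto simp: inj_on_def power2_eq_square)
qed

lemma two_eq_zero_iff_CHAR: "(2::'a::field) = 0 \<longleftrightarrow> CHAR('a) = 2"
proof -
  have "(2::'a) = 0 \<longleftrightarrow> CHAR('a) dvd 2"
    using of_nat_eq_0_iff_char_dvd[of 2, where 'a='a] by simp
  then show ?thesis using prime_nat_iff[of 2] CHAR_not_1[where 'a='a] by auto
qed

lemma three_eq_zero_iff_CHAR: "(3::'a::field) = 0 \<longleftrightarrow> CHAR('a) = 3"
proof -
  have "(3::'a) = 0 \<longleftrightarrow> CHAR('a) dvd 3"
    using of_nat_eq_0_iff_char_dvd[of 3, where 'a='a] by simp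
  then show ?thesis using prime_nat_iff[of 3] CHAR_not_1[where 'a='a] by auto
qed

text \<open>The second coordinate forces c = 0, then the first 2b = 0 and the last r = 3a + 3ub,
  while d is always free. If 2 and 3 are invertible, b = 0 and a = r/3; in characteristic 2, b is
  free and determines a; in characteristic 3, b = 0 and a is free, provided that r = 0.\<close>

lemma card_fixed_unipotent:
  fixes u :: "'a::{field,finite}"
  assumes "u \<noteq> 0"
  shows "CHAR('a) \<noteq> 2 \<Longrightarrow> CHAR('a) \<noteq> 3 \<Longrightarrow> card (shift_fixed r u 1) = CARD('a)"
    and "CHAR('a) = 2 \<Longrightarrow> card (shift_fixed r u 1) = CARD('a)^2"
    and "CHAR('a) = 3 \<Longrightarrow> card (shift_fixed r u 1) = (if r = 0 then CARD('a)^2 else 0)"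
proof -
  have *: "shift r (u, 1) (a, b, c, d) = (a, b, c, d) \<longleftrightarrow>
      c = 0 \<and> 2 * b = 0 \<and> r = 3 * a + 3 * u * b" for a b c d
  proof -
    have "(d + u * r - 3 * u * a - 3 * u^2 * b) - d = u * (r - (3 * a + 3 * u * b))"
      by (simp add: algebra_simps power2_eq_square)
    then have "d + u * r - 3 * u * a - 3 * u^2 * b = d \<longleftrightarrow> r = 3 * a + 3 * u * b"
      using assms by (metis eq_iff_diff_eq_0 mult_eq_0_iff)
    then show ?thesis using assms by (cases "c = 0") auto
  qed
  note two = two_eq_zero_iff_CHAR[where 'a='a] and three = three_eq_zero_iff_CHAR[where 'a='a]
  show "card (shift_fixed r u 1) = CARD('a)" if "CHAR('a) \<noteq> 2" "CHAR('a) \<noteq> 3"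
  proof -
    have "shift_fixed r u 1 = (\<lambda>d. (r/3, 0, 0, d)) ` UNIV"
      using that two three by (auto simp del: shift.simps simp: * field_simps)
    then show ?thesis by (simp add: card_image inj_on_def)
  qed
  show "card (shift_fixed r u 1) = CARD('a)^2" if "CHAR('a) = 2"
  proof -
    have "(2::'a) = 0" using that two by simp
    moreover have "(3::'a) = 2 + 1" by simp
    ultimately have "(3::'a) = 1" by simp
    have "shift_fixed r u 1 = (\<lambda>(b, d). (r - u * b, b, 0, d)) ` UNIV"
      using \<open>(2::'a) = 0\<close> \<open>(3::'a) = 1\<close>
      by (auto simp del: shift.simps simp: * image_iff)
    then show ?thesis
      by (subst \<open>shift_fixed r u 1 = _\<close>, subst card_image) (auto simp: inj_on_def power2_eq_square)
  qed
  show "card (shift_fixed r u 1) = (if r = 0 then CARD('a)^2 else 0)" if "CHAR('a) = 3"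
  proof (cases "r = 0")
    case True
    have z: "(3::'a) = 0" "(2::'a) \<noteq> 0" using that two three by auto
    have "shift_fixed r u 1 = (\<lambda>(a, d). (a, 0, 0, d)) ` UNIV"
      using z True by (auto simp del: shift.simps simp: *[unfolded True] image_iff)
    then show ?thesis using True
      by (subst \<open>shift_fixed r u 1 = _\<close>, subst card_image) (auto simp: inj_on_def power2_eq_square)
  next
    case False
    have z: "(3::'a) = 0" using that three by auto
    have "shift_fixed r u 1 = {}"
      using z False by (auto simp del: shift.simps simp: * image_iff)
    then show ?thesis using False by simp
  qed
qed

lemma card_fixed_one: "card (shift_fixed r 0 (1::'a::{field,finite})) = CARD('a)^4"
proof -
  have "shift_fixed r 0 (1::'a) = UNIV" by auto
  then show ?thesis by (simp add: power4_eq_xxxx)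
qed

text \<open>The Burnside sum is sorted by v: v = 1 contributes q^4 for the identity and q - 1 equal
  unipotent counts, v = -1 contributes q^3 if it differs from 1, and every other v contributes q^2.
  The total is divided by the group order q(q - 1).\<close>

lemma card_shift_orbits:
  fixes f :: "'a::{field,finite} \<times> 'a \<times> 'a \<times> 'a \<Rightarrow> 'b" and r :: 'a
  assumes orb: "\<And>p p'. f p = f p' \<longleftrightarrow> (\<exists>g\<in>UNIV \<times> - {0}. shift r g p' = p)"
  defines "q \<equiv> CARD('a)"
  shows "CHAR('a) \<noteq> 2 \<Longrightarrow> CHAR('a) \<noteq> 3 \<Longrightarrow> card (range f) = q^2 + 3 * q + 1"
    and "CHAR('a) = 2 \<Longrightarrow> card (range f) = q^2 + 3 * q"
    and "CHAR('a) = 3 \<Longrightarrow> card (range f) = (if r = 0 then q^2 + 4 * q else q^2 + 3 * q)"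
proof -
  define U where "U = card (shift_fixed r 1 1)"
  define F where "F = (\<lambda>u v. card (shift_fixed r u v))"
  have FU: "F u 1 = U" if "u \<noteq> 0" for u
    unfolding F_def U_def using card_fixed_unipotent[OF that, of r]
      card_fixed_unipotent[OF one_neq_zero, of r]
    by (cases "CHAR('a) = 2"; cases "CHAR('a) = 3") simp_all
  have q2: "q \<ge> 2"
  proof -
    have "card {0, 1 :: 'a} = 2" by simp
    then show ?thesis unfolding q_def by (metis card_mono finite subset_UNIV)
  qed
  have cardG: "card (UNIV \<times> - {0} :: ('a \<times> 'a) set) = q * (q - 1)"
    by (simp add: card_cartesian_product q_def Compl_eq_Diff_UNIV card_Diff_subset)
  have "card (range f) * (q * (q - 1)) = (\<Sum>g\<in>UNIV \<times> - {0}. card {p\<in>UNIV. shift r g p = p})"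
    unfolding cardG[symmetric]
  proof (rule card_image_orbits[where mul = shift_mul])
    show "shift r (shift_mul g h) p = shift r g (shift r h p)"
      if "g \<in> UNIV \<times> - {0}" "h \<in> UNIV \<times> - {0}" for g h p
    proof -
      have "snd g \<noteq> 0" "snd h \<noteq> 0" using that by auto
      from shift_shift_mul[OF this, of r "fst g" "fst h" p] show ?thesis by simp
    qed
    show "bij_betw (\<lambda>g. shift_mul g h) (UNIV \<times> - {0}) (UNIV \<times> - {0})"
      if "h \<in> UNIV \<times> - {0}" for h :: "'a \<times> 'a"
    proof -
      have "snd h \<noteq> 0" using that by auto
      from bij_shift_mul[OF this, of "fst h"] show ?thesis by simp
    qed
  qed (simp_all add: orb)
  also have "\<dots> = (\<Sum>v\<in>- {0}. \<Sum>u\<in>UNIV. F u v)"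
    by (subst sum.swap) (simp add: sum.cartesian_product F_def split_def)
  finally have total: "card (range f) * (q * (q - 1)) = (\<Sum>v\<in>- {0}. \<Sum>u\<in>UNIV. F u v)" .
  have one: "(\<Sum>u\<in>UNIV. F u 1) = q^4 + (q - 1) * U"
  proof -
    have "(\<Sum>u\<in>UNIV. F u 1) = F 0 1 + (\<Sum>u\<in>UNIV - {0}. F u 1)"
      by (rule sum.remove) auto
    also have "(\<Sum>u\<in>UNIV - {0}. F u 1) = (\<Sum>u\<in>(UNIV - {0} :: 'a set). U)"
      using FU by (intro sum.cong) auto
    finally show ?thesis by (simp add: F_def card_fixed_one q_def card_Diff_subset)
  qed
  have generic: "(\<Sum>v\<in>V. \<Sum>u\<in>UNIV. F u v) = card V * q^2"
    if "\<And>v. v \<in> V \<Longrightarrow> v \<noteq> 0 \<and> v^2 \<noteq> 1" for V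
    using that by (simp add: F_def card_fixed_generic q_def power2_eq_square)
  \<comment> \<open>The generic v avoid 0 and 1 if -1 = 1, and 0, 1 and -1 otherwise; hence the
    factors q - 2 and q - 3.\<close>
  have sum: "(\<Sum>v\<in>- {0}. \<Sum>u\<in>UNIV. F u v) =
      (if CHAR('a) = 2 then q^4 + (q - 1) * U + (q - 2) * q^2
       else q^4 + (q - 1) * U + q^3 + (q - 3) * q^2)"
  proof (cases "CHAR('a) = 2")
    case True
    then have "(2::'a) = 0" by (simp add: two_eq_zero_iff_CHAR)
    then have "(-1::'a) = 1" by (metis add_eq_0_iff one_add_one)
    have split: "- {0} = insert 1 (- {0, 1 :: 'a})" by auto
    have "(\<Sum>v\<in>- {0}. \<Sum>u\<in>UNIV. F u v) = q^4 + (q - 1) * U + (\<Sum>v\<in>- {0, 1}. \<Sum>u\<in>UNIV. F u v)"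
      unfolding split one[symmetric] by (subst sum.insert) auto
    also have "(\<Sum>v\<in>- {0, 1}. \<Sum>u\<in>UNIV. F u v) = card (- {0, 1 :: 'a}) * q^2"
      using \<open>(-1::'a) = 1\<close> by (intro generic) (auto simp: power2_eq_1_iff)
    also have "card (- {0, 1 :: 'a}) = q - 2"
      by (simp add: Compl_eq_Diff_UNIV card_Diff_subset q_def)
    finally show ?thesis using True by simp
  next
    case False
    then have two: "(2::'a) \<noteq> 0" by (simp add: two_eq_zero_iff_CHAR)
    then have ne: "(-1::'a) \<noteq> 1" by (metis add.right_inverse one_add_one)
    have split: "- {0} = insert 1 (insert (-1) (- {0, 1, -1 :: 'a}))" by auto
    have "(\<Sum>v\<in>- {0}. \<Sum>u\<in>UNIV. F u v) = q^4 + (q - 1) * U +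
        ((\<Sum>u\<in>UNIV. F u (-1)) + (\<Sum>v\<in>- {0, 1, -1}. \<Sum>u\<in>UNIV. F u v))"
      unfolding split one[symmetric] using ne by (subst sum.insert, force, force)+ auto
    also have "(\<Sum>v\<in>- {0, 1, -1}. \<Sum>u\<in>UNIV. F u v) = card (- {0, 1, -1 :: 'a}) * q^2"
      by (intro generic) (auto simp: power2_eq_1_iff)
    also have "card (- {0, 1, -1 :: 'a}) = q - 3"
      using ne by (simp add: Compl_eq_Diff_UNIV card_Diff_subset q_def)
    also have "(\<Sum>u\<in>UNIV. F u (-1)) = q^3"
      using two by (simp add: F_def card_fixed_minus_one q_def power3_eq_cube power2_eq_square)
    finally show ?thesis using False by simp
  qed
  \<comment> \<open>With this bound the truncated difference q - 3 is a genuine one; substituting q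
    = k + 3 (or k + 2 in characteristic 2) then leaves polynomial identities in k.\<close>
  have q3: "q \<ge> 3" if "CHAR('a) \<noteq> 2"
  proof -
    have "(2::'a) \<noteq> 0" using that by (simp add: two_eq_zero_iff_CHAR)
    then have "(-1::'a) \<noteq> 1" by (metis add.right_inverse one_add_one)
    then have "card {0, 1, -1 :: 'a} = 3" by simp
    then show ?thesis unfolding q_def by (metis card_mono finite subset_UNIV)
  qed
  have pos: "q * (q - 1) > 0" using q2 by simp
  have cancel: "card (range f) = n" if "n * (q * (q - 1)) = (\<Sum>v\<in>- {0}. \<Sum>u\<in>UNIV. F u v)" for n
    by (metis total that mult_cancel2 pos less_irrefl)
  {
    assume c: "CHAR('a) \<noteq> 2" "CHAR('a) \<noteq> 3"
    then have U: "U = q" by (simp add: U_def card_fixed_unipotent q_def)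
    obtain k where k: "q = k + 3" using q3[OF c(1)] by (metis add.commute le_Suc_ex)
    then have sub: "q - 1 = k + 2" "q - 3 = k" by simp_all
    show "card (range f) = q^2 + 3 * q + 1"
      by (rule cancel, unfold sum U, unfold sub, unfold k)
         (simp add: c sub algebra_simps power2_eq_square power3_eq_cube power4_eq_xxxx)
  next
    assume c: "CHAR('a) = 2"
    then have U: "U = q^2" by (simp add: U_def card_fixed_unipotent q_def)
    obtain k where k: "q = k + 2" using q2 by (metis add.commute le_Suc_ex)
    then have sub: "q - 1 = k + 1" "q - 2 = k" by simp_all
    show "card (range f) = q^2 + 3 * q"
      by (rule cancel, unfold sum U, unfold sub, unfold k)
         (simp add: c sub algebra_simps power2_eq_square power3_eq_cube power4_eq_xxxx)
  next
    assume c: "CHAR('a) = 3"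
    then have U: "U = (if r = 0 then q^2 else 0)" by (simp add: U_def card_fixed_unipotent q_def)
    obtain k where k: "q = k + 3" using q3 c by (metis add.commute le_Suc_ex numeral_eq_iff semiring_norm(88))
    then have sub: "q - 1 = k + 2" "q - 3 = k" by simp_all
    show "card (range f) = (if r = 0 then q^2 + 4 * q else q^2 + 3 * q)"
      by (rule cancel, unfold sum U, unfold sub, unfold k)
         (simp add: c sub algebra_simps power2_eq_square power3_eq_cube power4_eq_xxxx)
  }
qed

subsection \<open>Isomorphisms and traces\<close>

lemma linear_inv_bij:
  assumes "Vector_Spaces.linear s t f" "bij f"
  shows "Vector_Spaces.linear t s (inv f)"
proof (rule linear_mapI)
  show "vector_space s" "vector_space t"
    using assms(1) by (auto simp: Vector_Spaces.linear_def)
  have f: "f (inv f x) = x" "inv f (f y) = y" for x y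
    using assms(2) by (auto simp: bij_is_inj bij_is_surj surj_f_inv_f)
  show "inv f (x + y) = inv f x + inv f y" for x y
    by (metis f linear_mapD(1)[OF assms(1)])
  show "inv f (t c x) = s c (inv f x)" for c x
    by (metis f linear_mapD(2)[OF assms(1)])
qed

lemma algebra_isomorphic_refl:
  assumes "vector_space s"
  shows "algebra_isomorphic s m s m"
  unfolding algebra_isomorphic_def
  by (rule exI[of _ id]) (auto intro!: linear_mapI assms)

lemma algebra_isomorphic_sym:
  assumes "algebra_isomorphic s m s' m'"
  shows "algebra_isomorphic s' m' s m"
proof -
  obtain f where f: "Vector_Spaces.linear s s' f" "bij f" "\<And>x y. f (m x y) = m' (f x) (f y)"
    using assms unfolding algebra_isomorphic_def by blast
  have "inv f (m' x y) = m (inv f x) (inv f y)" for x y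
    using f(2,3) by (metis bij_inv_eq_iff)
  then show ?thesis
    unfolding algebra_isomorphic_def using linear_inv_bij[OF f(1,2)] bij_imp_bij_inv[OF f(2)] by blast
qed

lemma algebra_isomorphic_trans:
  assumes "algebra_isomorphic s m s' m'" "algebra_isomorphic s' m' s'' m''"
  shows "algebra_isomorphic s m s'' m''"
proof -
  obtain f g where f: "Vector_Spaces.linear s s' f" "bij f" "\<And>x y. f (m x y) = m' (f x) (f y)"
    and g: "Vector_Spaces.linear s' s'' g" "bij g" "\<And>x y. g (m' x y) = m'' (g x) (g y)"
    using assms unfolding algebra_isomorphic_def by blast
  have "Vector_Spaces.linear s s'' (g \<circ> f)"
    using Vector_Spaces.linear_compose f(1) g(1) by blast
  then show ?thesis
    unfolding algebra_isomorphic_def using bij_comp[OF f(2) g(2)] f(3) g(3)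
    by (intro exI[of _ "g \<circ> f"]) auto
qed

lemma iso_class_eq_iff:
  assumes "two_dim_algebra (*s) m" "two_dim_algebra (*s) m'"
  shows "algebra_iso_rel `` {m} = algebra_iso_rel `` {m'} \<longleftrightarrow> algebra_isomorphic (*s) m (*s) m'"
proof
  assume "algebra_iso_rel `` {m} = algebra_iso_rel `` {m'}"
  moreover have "m' \<in> algebra_iso_rel `` {m'}"
    using assms algebra_isomorphic_refl[OF vector_space_vec] by (auto simp: algebra_iso_rel_def)
  ultimately show "algebra_isomorphic (*s) m (*s) m'" by (auto simp: algebra_iso_rel_def)
next
  assume "algebra_isomorphic (*s) m (*s) m'"
  then show "algebra_iso_rel `` {m} = algebra_iso_rel `` {m'}"
    using assms by (auto simp: algebra_iso_rel_def intro: algebra_isomorphic_trans algebra_isomorphic_sym)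
qed

section \<open>Trace vectors as linear functionals\<close>

definition dot2 :: "'a::comm_ring_1^2 \<Rightarrow> 'a^2 \<Rightarrow> 'a" where
  "dot2 x y = x $ 1 * y $ 1 + x $ 2 * y $ 2"

lemma vec2_eq_iff: "x = y \<longleftrightarrow> x $ 1 = y $ 1 \<and> x $ 2 = y $ 2" for x y :: "'a^2"
  by (simp add: vec_eq_iff forall_2)

lemma two_dim_algebraD:
  assumes "two_dim_algebra (*s) m"
  shows "Vector_Spaces.linear (*s) (*s) (m x)" "Vector_Spaces.linear (*s) (*s) (\<lambda>y. m y x)"
  using assms by (auto simp: two_dim_algebra_def)

lemma linear_vec2_expand:
  fixes f :: "'a::field^2 \<Rightarrow> 'a^2"
  assumes "Vector_Spaces.linear (*s) (*s) f"
  shows "f x = x $ 1 *s f (axis 1 1) + x $ 2 *s f (axis 2 1)"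
proof -
  have "x = x $ 1 *s axis 1 1 + x $ 2 *s axis 2 1" by (simp add: vec2_eq_iff axis_def)
  then show ?thesis using linear_mapD[OF assms] by metis
qed

text \<open>The entries of \<open>tr1\<close> are the traces of right multiplication by the two
  basis vectors, and those of \<open>tr2\<close> below belong to left multiplication. This
  basis-free reading makes invariance under isomorphism accessible.\<close>

lemma dot2_tr1:
  assumes "two_dim_algebra (*s) m"
  shows "dot2 (tr1 (structure_matrix m)) x = trace (matrix (\<lambda>y. m y x))"
  using linear_vec2_expand[OF two_dim_algebraD(1)[OF assms, of "axis 1 1"], of x]
    linear_vec2_expand[OF two_dim_algebraD(1)[OF assms, of "axis 2 1"], of x]
  by (simp add: dot2_def tr1_def structure_matrix_nth trace_def sum_2 matrix_def algebra_simps)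

lemma dot2_tr2:
  assumes "two_dim_algebra (*s) m"
  shows "dot2 (tr2 (structure_matrix m)) x = trace (matrix (m x))"
  using linear_vec2_expand[OF two_dim_algebraD(2)[OF assms, of "axis 1 1"], of x]
    linear_vec2_expand[OF two_dim_algebraD(2)[OF assms, of "axis 2 1"], of x]
  by (simp add: dot2_def tr2_def structure_matrix_nth trace_def sum_2 matrix_def algebra_simps)

text \<open>Here \<open>g'\<close> is the conjugate of \<open>g\<close> by \<open>f\<close>, so the
  cyclic property of the trace cancels \<open>f\<close> against its inverse.\<close>

lemma trace_matrix_conjugate:
  fixes f :: "'a::field^'n \<Rightarrow> 'a^'n"
  assumes f: "Vector_Spaces.linear (*s) (*s) f" "bij f"
    and g: "Vector_Spaces.linear (*s) (*s) g" "Vector_Spaces.linear (*s) (*s) g'"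
    and fg: "\<And>x. f (g x) = g' (f x)"
  shows "trace (matrix g') = trace (matrix g)"
proof -
  note lin = f(1) linear_inv_bij[OF f] g
  have "g' = f \<circ> (g \<circ> inv f)"
    using f(2) fg by (simp add: fun_eq_iff bij_is_surj surj_f_inv_f)
  then have "matrix g' = matrix f ** (matrix g ** matrix (inv f))"
    by (simp add: matrix_compose_gen lin Vector_Spaces.linear_compose[of "(*s)" "(*s)" _ "(*s)"])
  then have "trace (matrix g') = trace ((matrix g ** matrix (inv f)) ** matrix f)"
    by (metis trace_mul_sym)
  also have "\<dots> = trace (matrix g ** matrix (inv f \<circ> f))"
    by (simp add: matrix_mul_assoc matrix_compose_gen lin)
  also have "inv f \<circ> f = id" using f(2) by (simp add: bij_is_inj)
  finally show ?thesis unfolding matrix_id_mat_1 by simp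
qed

text \<open>An isomorphism conjugates multiplication by \<open>x\<close>, on either side, into
  multiplication by \<open>f x\<close>.\<close>

lemma iso_traces:
  assumes alg: "two_dim_algebra (*s) m" "two_dim_algebra (*s) m'"
    and f: "Vector_Spaces.linear (*s) (*s) f" "bij f" "\<And>x y. f (m x y) = m' (f x) (f y)"
  shows "dot2 (tr1 (structure_matrix m')) (f x) = dot2 (tr1 (structure_matrix m)) x"
    and "dot2 (tr2 (structure_matrix m')) (f x) = dot2 (tr2 (structure_matrix m)) x"
  unfolding dot2_tr1[OF alg(1)] dot2_tr1[OF alg(2)] dot2_tr2[OF alg(1)] dot2_tr2[OF alg(2)]
  by (rule trace_matrix_conjugate[OF f(1,2)]; simp add: f(3) two_dim_algebraD alg)+

text \<open>
  The algebra with trace vectors \<open>\<sigma>\<close>, \<open>\<tau>\<close> whose structure constants not determined by them are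
  \<open>(\<alpha>\<^sub>1, \<alpha>\<^sub>2, \<alpha>\<^sub>4, \<beta>\<^sub>1) = (a, b, c, d)\<close>.
\<close>

definition alg :: "'a::field^2 \<Rightarrow> 'a^2 \<Rightarrow> 'a \<times> 'a \<times> 'a \<times> 'a \<Rightarrow> 'a^2 \<Rightarrow> 'a^2 \<Rightarrow> 'a^2" where
  "alg \<sigma> \<tau> = (\<lambda>(a, b, c, d) x y. vector
     [a * x$1 * y$1 + b * x$1 * y$2 + (\<tau>$2 - \<sigma>$2 + b) * x$2 * y$1 + c * x$2 * y$2,
      d * x$1 * y$1 + (\<tau>$1 - a) * x$1 * y$2 + (\<sigma>$1 - a) * x$2 * y$1 + (\<sigma>$2 - b) * x$2 * y$2])"

lemma two_dim_algebra_alg: "two_dim_algebra (*s) (alg \<sigma> \<tau> p)"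
proof (cases p)
  case (fields a b c d)
  show ?thesis
    unfolding two_dim_algebra_def
    by (intro conjI allI vec_dim_2 vector_space_vec linear_mapI)
       (simp_all add: fields alg_def vec2_eq_iff algebra_simps)
qed

lemma structure_matrix_alg:
  "structure_matrix (alg \<sigma> \<tau> (a, b, c, d)) $ 1 $ 1 = a"
  "structure_matrix (alg \<sigma> \<tau> (a, b, c, d)) $ 1 $ 2 = b"
  "structure_matrix (alg \<sigma> \<tau> (a, b, c, d)) $ 1 $ 4 = c"
  "structure_matrix (alg \<sigma> \<tau> (a, b, c, d)) $ 2 $ 1 = d"
  by (simp_all add: structure_matrix_nth alg_def axis_def)

lemma traces_alg:
  "tr1 (structure_matrix (alg \<sigma> \<tau> p)) = \<sigma>" "tr2 (structure_matrix (alg \<sigma> \<tau> p)) = \<tau>"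
  by (cases p; simp add: tr1_def tr2_def structure_matrix_nth alg_def axis_def vec2_eq_iff)+

lemma alg_eq_iff: "alg \<sigma> \<tau> p = alg \<sigma> \<tau> p' \<longleftrightarrow> p = p'"
  by (cases p; cases p') (metis structure_matrix_alg)

text \<open>The four trace equations can be solved for the remaining constants \<alpha>3, \<beta>2,
  \<beta>3 and \<beta>4, so the traces and (\<alpha>1, \<alpha>2, \<alpha>4, \<beta>1) are
  coordinates on all algebras.\<close>

lemma two_dim_algebra_eq_alg:
  assumes "two_dim_algebra (*s) m"
  defines "S \<equiv> structure_matrix m"
  shows "m = alg (tr1 S) (tr2 S) (S$1$1, S$1$2, S$1$4, S$2$1)"
proof (intro ext)
  fix x y
  note lin = linear_vec2_expand[OF two_dim_algebraD(1)[OF assms(1)]]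
    linear_vec2_expand[OF two_dim_algebraD(2)[OF assms(1)]]
  have "m x y = x$1 *s (y$1 *s m (axis 1 1) (axis 1 1) + y$2 *s m (axis 1 1) (axis 2 1))
      + x$2 *s (y$1 *s m (axis 2 1) (axis 1 1) + y$2 *s m (axis 2 1) (axis 2 1))"
    using lin(2)[of x y] lin(1)[of "axis 1 1" y] lin(1)[of "axis 2 1" y] by simp
  then show "m x y = alg (tr1 S) (tr2 S) (S$1$1, S$1$2, S$1$4, S$2$1) x y"
    by (simp add: vec2_eq_iff alg_def S_def structure_matrix_nth tr1_def tr2_def algebra_simps)
qed

subsection \<open>Normalised trace vectors\<close>

text \<open>An isomorphism preserves both functionals, one of which is a non-zero multiple of the
  first coordinate. It therefore fixes that coordinate and has the form (x1, u x1 + v x2) with v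
  non-zero; comparing products of basis vectors yields \<open>shift\<close>.\<close>

lemma alg_isomorphic_shift_iff:
  fixes s t :: "'a::field"
  assumes st: "s \<noteq> 0 \<or> t \<noteq> 0"
  defines "A \<equiv> alg (vector [s, 0]) (vector [t, 0])"
  shows "algebra_isomorphic (*s) (A p) (*s) (A p') \<longleftrightarrow>
    (\<exists>g\<in>UNIV \<times> - {0}. shift (s + t) g p' = p)"
proof -
  obtain a b c d where p': "p' = (a, b, c, d)" by (cases p')
  obtain a' b' c' d' where p: "p = (a', b', c', d')" by (cases p)
  have alg: "two_dim_algebra (*s) (A p)" for p by (simp add: A_def two_dim_algebra_alg)
  show ?thesis
  proof
    assume "algebra_isomorphic (*s) (A p) (*s) (A p')"
    then obtain f where f: "Vector_Spaces.linear (*s) (*s) f" "bij f"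
      and hom: "\<And>x y. f (A p x y) = A p' (f x) (f y)"
      unfolding algebra_isomorphic_def by blast
    have f1: "f x $ 1 = x $ 1" for x
      using iso_traces[where m="A p" and m'="A p'" and f=f and x=x, OF alg alg f hom] st
      unfolding A_def traces_alg dot2_def by auto
    define u where "u = f (axis 1 1) $ 2"
    define v where "v = f (axis 2 1) $ 2"
    have fx: "f x = vector [x $ 1, u * x $ 1 + v * x $ 2]" for x
    proof -
      have "f x $ 2 = x $ 1 * u + x $ 2 * v"
        by (subst linear_vec2_expand[OF f(1)]) (simp add: u_def v_def)
      then show ?thesis by (simp add: vec2_eq_iff f1 mult.commute)
    qed
    have "v \<noteq> 0"
    proof
      assume "v = 0"
      then have "f (axis 2 1) = f 0" by (simp add: fx vec2_eq_iff axis_def)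
      then have "(axis 2 1 :: 'a^2) = 0" using f(2) by (simp add: bij_is_inj inj_eq)
      then show False by (simp add: vec2_eq_iff axis_def)
    qed
    \<comment> \<open>The second coordinate of the image of e1 e1. It still involves a'; eliminating
      a' later produces the coefficients 3 and the cubic term.\<close>
    have d: "u * a' + v * d' = d + (s + t - 2 * a) * u - b * u^2"
      using arg_cong[OF hom[of "axis 1 1" "axis 1 1"], of "\<lambda>z. z $ 2"]
      by (simp add: fx A_def alg_def p p' axis_def algebra_simps power2_eq_square)
    have "a' = a + 2 * u * b + u^2 * c"
      using hom[of "axis 1 1" "axis 1 1"]
      by (simp add: fx A_def alg_def p p' vec2_eq_iff axis_def algebra_simps power2_eq_square)
    moreover have "b' = v * (b + u * c)"
      using hom[of "axis 1 1" "axis 2 1"]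
      by (simp add: fx A_def alg_def p p' vec2_eq_iff axis_def algebra_simps)
    moreover have "c' = v^2 * c"
      using hom[of "axis 2 1" "axis 2 1"]
      by (simp add: fx A_def alg_def p p' vec2_eq_iff axis_def algebra_simps power2_eq_square)
    moreover have "d' = (d + u * (s + t) - 3 * u * a - 3 * u^2 * b - u^3 * c) / v"
    proof -
      have "d' * v = d + u * (s + t) - 3 * u * a - 3 * u^2 * b - u^3 * c"
        using d calculation(1) by algebra
      then show ?thesis using \<open>v \<noteq> 0\<close> by (simp add: eq_divide_eq)
    qed
    ultimately have "shift (s + t) (u, v) p' = p" by (simp add: p p')
    then show "\<exists>g\<in>UNIV \<times> - {0}. shift (s + t) g p' = p"
      using \<open>v \<noteq> 0\<close> by (intro bexI[of _ "(u, v)"]) auto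
  next
    assume "\<exists>g\<in>UNIV \<times> - {0}. shift (s + t) g p' = p"
    then obtain u v where v: "v \<noteq> 0" and eq: "shift (s + t) (u, v) p' = p" by auto
    define f where "f = (\<lambda>x::'a^2. vector [x $ 1, u * x $ 1 + v * x $ 2] :: 'a^2)"
    have lin: "Vector_Spaces.linear (*s) (*s) f"
      by (intro linear_mapI vector_space_vec) (simp_all add: f_def vec2_eq_iff algebra_simps)
    have bij: "bij f"
      by (rule o_bij[of "\<lambda>x. vector [x $ 1, (x $ 2 - u * x $ 1) / v]"])
         (use v in \<open>simp_all add: fun_eq_iff f_def vec2_eq_iff\<close>)
    have pd: "a' = a + 2 * u * b + u^2 * c" "b' = v * (b + u * c)" "c' = v^2 * c"
      "v * d' = d + u * (s + t) - 3 * u * a - 3 * u^2 * b - u^3 * c"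
      using eq v by (auto simp: p p')
    have "f (A p x y) = A p' (f x) (f y)" for x y
    proof -
      \<comment> \<open>The product v d' is kept together, so that its value can be inserted without
        a division.\<close>
      have "f (A p x y) $ 2 = u * A p x y $ 1 + (v * d') * x$1 * y$1
          + v * ((t - a') * x$1 * y$2 + (s - a') * x$2 * y$1 - b' * x$2 * y$2)"
        by (simp add: f_def A_def alg_def p algebra_simps)
      also have "\<dots> = A p' (f x) (f y) $ 2"
        unfolding pd(4)
        by (simp add: f_def A_def alg_def p p' pd(1-3) algebra_simps power2_eq_square power3_eq_cube)
      finally have "f (A p x y) $ 2 = A p' (f x) (f y) $ 2" .
      moreover have "f (A p x y) $ 1 = A p' (f x) (f y) $ 1"
        by (simp add: f_def A_def alg_def p p' pd(1-3) algebra_simps power2_eq_square)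
      ultimately show ?thesis by (simp add: vec2_eq_iff)
    qed
    then show "algebra_isomorphic (*s) (A p) (*s) (A p')"
      unfolding algebra_isomorphic_def using lin bij by blast
  qed
qed

text \<open>The two trace functionals are now the coordinates themselves, so an isomorphism
  preserves both and is the identity.\<close>

lemma alg_isomorphic_dual_basis_iff:
  "algebra_isomorphic (*s) (alg (vector [1, 0]) (vector [0, 1]) p)
     (*s) (alg (vector [1, 0]) (vector [0, 1]) p') \<longleftrightarrow> p = p'"
proof
  let ?A = "alg (vector [1, 0]) (vector [0, 1])"
  assume "algebra_isomorphic (*s) (?A p) (*s) (?A p')"
  then obtain f where f: "Vector_Spaces.linear (*s) (*s) f" "bij f"
    and hom: "\<And>x y. f (?A p x y) = ?A p' (f x) (f y)"
    unfolding algebra_isomorphic_def by blast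
  have "f x = x" for x
    using iso_traces[where m="?A p" and m'="?A p'" and f=f and x=x,
      OF two_dim_algebra_alg two_dim_algebra_alg f hom]
    by (simp add: traces_alg dot2_def vec2_eq_iff)
  then have "?A p = ?A p'" using hom by (metis ext)
  then show "p = p'" by (simp add: alg_eq_iff)
qed (simp add: algebra_isomorphic_refl vector_space_vec)

text \<open>One pair of trace vectors from each orbit of \<open>GL\<^sub>2\<close> on the non-zero pairs: an independent pair
  can be moved to the standard basis, a dependent one to multiples of \<open>e\<^sub>1\<close>, and the
  multiples are determined up to a common factor.\<close>

definition line_reps :: "('a::field \<times> 'a) set" where
  "line_reps = insert (0, 1) (range (Pair 1))"

definition trace_reps :: "(('a::field^2) \<times> ('a^2)) set" where
  "trace_reps = insert (vector [1, 0], vector [0, 1])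
     ((\<lambda>(s, t). (vector [s, 0], vector [t, 0])) ` line_reps)"

section \<open>Uniqueness and existence of the normalised trace vectors\<close>

lemma trace_reps_cases:
  assumes "(\<sigma>, \<tau>) \<in> trace_reps"
  obtains "\<sigma> = vector [1, 0]" "\<tau> = vector [0, 1]"
  | s t where "(s, t) \<in> line_reps" "\<sigma> = vector [s, 0]" "\<tau> = vector [t, 0]"
  using assms unfolding trace_reps_def by auto

text \<open>Transporting the functionals rules out an independent pair against a dependent one. Two
  dependent pairs differ by the common factor \<open>f (axis 1 1) $ 1\<close>, and the normalisation
  in \<open>line_reps\<close> leaves no choice.\<close>

lemma trace_reps_unique:
  assumes "(\<sigma>, \<tau>) \<in> trace_reps" "(\<sigma>', \<tau>') \<in> trace_reps"
    and iso: "algebra_isomorphic (*s) (alg \<sigma> \<tau> p) (*s) (alg \<sigma>' \<tau>' p')"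
  shows "\<sigma> = \<sigma>' \<and> \<tau> = \<tau>'"
proof -
  have transport: "\<exists>f. \<forall>x. dot2 \<sigma>' (f x) = dot2 \<sigma> x \<and> dot2 \<tau>' (f x) = dot2 \<tau> x"
    if iso: "algebra_isomorphic (*s) (alg \<sigma> \<tau> p) (*s) (alg \<sigma>' \<tau>' p')" for \<sigma> \<tau> \<sigma>' \<tau>' :: "'a^2" and p p'
  proof -
    obtain f where f: "Vector_Spaces.linear (*s) (*s) f" "bij f"
      and hom: "\<And>x y. f (alg \<sigma> \<tau> p x y) = alg \<sigma>' \<tau>' p' (f x) (f y)"
      using iso unfolding algebra_isomorphic_def by blast
    show ?thesis
      using iso_traces[where m="alg \<sigma> \<tau> p" and m'="alg \<sigma>' \<tau>' p'" and f=f,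
        OF two_dim_algebra_alg two_dim_algebra_alg f hom] by (auto simp: traces_alg)
  qed
  \<comment> \<open>At \<open>axis 1 1\<close> the equations force t = 0, against the second
    equation at \<open>axis 2 1\<close>.\<close>
  have mixed: False if "\<forall>x. dot2 (vector [s, 0]) (f x) = dot2 (vector [1, 0]) x \<and>
      dot2 (vector [t, 0]) (f x) = dot2 (vector [0, 1]) x" for s t and f :: "'a^2 \<Rightarrow> 'a^2"
    using that[THEN spec, of "axis 1 1"] that[THEN spec, of "axis 2 1"]
    by (auto simp: dot2_def axis_def)
  from assms(1) show ?thesis
  proof (cases rule: trace_reps_cases)
    case 1
    note st = this
    from assms(2) show ?thesis
    proof (cases rule: trace_reps_cases)
      case 1
      with st show ?thesis by simp
    next
      case 2
      with st transport[OF iso] mixed show ?thesis by blast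
    qed
  next
    case (2 s t)
    note st = this
    from assms(2) show ?thesis
    proof (cases rule: trace_reps_cases)
      case 1
      with st transport[OF algebra_isomorphic_sym[OF iso]] mixed show ?thesis by blast
    next
      case (2 s' t')
      obtain f where f: "\<And>x. dot2 \<sigma>' (f x) = dot2 \<sigma> x \<and> dot2 \<tau>' (f x) = dot2 \<tau> x"
        using transport[OF iso] by blast
      have "s' * f (axis 1 1) $ 1 = s" "t' * f (axis 1 1) $ 1 = t"
        using f[of "axis 1 1"] by (simp_all add: st 2 dot2_def axis_def)
      then show ?thesis using st 2 by (auto simp: line_reps_def)
    qed
  qed
qed

text \<open>Rewriting \<open>m\<close> in a basis \<open>b1\<close>, \<open>b2\<close> turns its
  trace vectors into the values of the two functionals on that basis, so it suffices to choose the
  basis with these values in \<open>trace_reps\<close>.\<close>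

lemma nonzero_traces_representative:
  fixes m :: "'a::field^2 \<Rightarrow> 'a^2 \<Rightarrow> 'a^2"
  assumes alg: "two_dim_algebra (*s) m"
    and nz: "tr1 (structure_matrix m) \<noteq> 0 \<or> tr2 (structure_matrix m) \<noteq> 0"
  obtains \<sigma> \<tau> p where "(\<sigma>, \<tau>) \<in> trace_reps" "algebra_isomorphic (*s) (alg \<sigma> \<tau> p) (*s) m"
proof -
  define \<sigma> where "\<sigma> = tr1 (structure_matrix m)"
  define \<tau> where "\<tau> = tr2 (structure_matrix m)"
  note found = that
  have basis: thesis
    if det: "b1 $ 1 * b2 $ 2 - b1 $ 2 * b2 $ 1 \<noteq> 0"
      and rep: "(vector [dot2 \<sigma> b1, dot2 \<sigma> b2], vector [dot2 \<tau> b1, dot2 \<tau> b2]) \<in> trace_reps"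
    for b1 b2 :: "'a^2"
  proof -
    have ne: "b1 \<noteq> b2" using det by (auto simp: algebra_simps)
    have span: "vec.span {b1, b2} = UNIV"
    proof -
      have "x \<in> vec.span {b1, b2}" for x
      proof -
        let ?D = "b1 $ 1 * b2 $ 2 - b1 $ 2 * b2 $ 1"
        \<comment> \<open>Cramer's rule.\<close>
        have "x = ((x $ 1 * b2 $ 2 - x $ 2 * b2 $ 1) / ?D) *s b1
            + ((b1 $ 1 * x $ 2 - b1 $ 2 * x $ 1) / ?D) *s b2"
          using det by (simp add: vec2_eq_iff divide_simps) (simp add: algebra_simps)
        then show ?thesis
          by (metis insertI1 insertI2 vec.span_add vec.span_base vec.span_scale)
      qed
      then show ?thesis by auto
    qed
    have indep: "vec.independent {b1, b2}"
      by (rule vec.card_le_dim_spanning[of _ UNIV]) (use ne span vec_dim_2[where 'a='a] in auto)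
    obtain m' and h :: "'a^2 \<Rightarrow> 'a^2" where m': "two_dim_algebra (*s) m'"
      and h: "Vector_Spaces.linear (*s) (*s) h" "bij h" "\<And>x y. h (m' x y) = m (h x) (h y)"
      and hb: "h (axis 1 1) = b1" "h (axis 2 1) = b2"
      and iso: "algebra_isomorphic (*s) m' (*s) m"
      using two_dim_algebra_representative[OF alg ne indep span] by metis
    have "tr1 (structure_matrix m') = vector [dot2 \<sigma> b1, dot2 \<sigma> b2]"
      "tr2 (structure_matrix m') = vector [dot2 \<tau> b1, dot2 \<tau> b2]"
      using iso_traces[where m=m' and m'=m and f=h and x="axis 1 1", OF m' alg h]
        iso_traces[where m=m' and m'=m and f=h and x="axis 2 1", OF m' alg h]
      by (simp_all add: hb \<sigma>_def \<tau>_def vec2_eq_iff) (simp_all add: dot2_def axis_def)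
    then show thesis
      using found rep iso two_dim_algebra_eq_alg[OF m'] by metis
  qed
  \<comment> \<open>In the dependent case \<open>\<rho>\<close> is the functional to be normalised
    to 1: \<open>\<sigma>\<close> if it is non-zero, otherwise \<open>\<tau>\<close>. The vector
    \<open>b2\<close> spans its kernel, on which the other functional vanishes too.\<close>
  have line: thesis if "\<sigma> $ 1 * \<tau> $ 2 = \<sigma> $ 2 * \<tau> $ 1" "\<rho> \<noteq> 0" "\<rho> = \<sigma> \<or> \<rho> = \<tau> \<and> \<sigma> = 0" for \<rho>
  proof -
    define b1 :: "'a^2" where
      "b1 = (if \<rho> $ 1 \<noteq> 0 then vector [1 / \<rho> $ 1, 0] else vector [0, 1 / \<rho> $ 2])"
    define b2 :: "'a^2" where "b2 = vector [- \<rho> $ 2, \<rho> $ 1]"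
    have b1: "dot2 \<rho> b1 = 1"
      using that(2) by (auto simp: b1_def dot2_def vec2_eq_iff)
    have b2: "dot2 \<sigma> b2 = 0" "dot2 \<tau> b2 = 0"
      using that(1,3) by (auto simp: b2_def dot2_def algebra_simps)
    show thesis
    proof (rule basis)
      \<comment> \<open>By the choice of \<open>b2\<close> this determinant is
        \<open>dot2 \<rho> b1\<close>, which is 1.\<close>
      show "b1 $ 1 * b2 $ 2 - b1 $ 2 * b2 $ 1 \<noteq> 0"
        using b1 by (simp add: b2_def dot2_def algebra_simps)
      have "(dot2 \<sigma> b1, dot2 \<tau> b1) \<in> line_reps"
        using that(3) b1 by (auto simp: line_reps_def dot2_def)
      then show "(vector [dot2 \<sigma> b1, dot2 \<sigma> b2], vector [dot2 \<tau> b1, dot2 \<tau> b2]) \<in> trace_reps"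
        unfolding b2 trace_reps_def by force
    qed
  qed
  show thesis
  proof (cases "\<sigma> $ 1 * \<tau> $ 2 = \<sigma> $ 2 * \<tau> $ 1")
    case True
    then show thesis using line[of \<sigma>] line[of \<tau>] nz unfolding \<sigma>_def \<tau>_def by blast
  next
    case False
    define D where "D = \<sigma> $ 1 * \<tau> $ 2 - \<sigma> $ 2 * \<tau> $ 1"
    have D: "D \<noteq> 0" using False by (simp add: D_def)
    \<comment> \<open>The basis dual to \<open>\<sigma>\<close>, \<open>\<tau>\<close>: the columns
      of the inverse of the matrix with these rows.\<close>
    define b1 :: "'a^2" where "b1 = vector [\<tau> $ 2 / D, - \<tau> $ 1 / D]"
    define b2 :: "'a^2" where "b2 = vector [- \<sigma> $ 2 / D, \<sigma> $ 1 / D]"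
    have dual: "dot2 \<sigma> b1 = 1" "dot2 \<sigma> b2 = 0" "dot2 \<tau> b1 = 0" "dot2 \<tau> b2 = 1"
      using D by (simp_all add: b1_def b2_def dot2_def field_simps) (simp_all add: D_def algebra_simps)
    show thesis
    proof (rule basis)
      have "b1 $ 1 * b2 $ 2 - b1 $ 2 * b2 $ 1 = D / (D * D)"
        by (simp add: b1_def b2_def D_def diff_divide_distrib mult.commute)
      then show "b1 $ 1 * b2 $ 2 - b1 $ 2 * b2 $ 1 \<noteq> 0" using D by simp
      show "(vector [dot2 \<sigma> b1, dot2 \<sigma> b2], vector [dot2 \<tau> b1, dot2 \<tau> b2]) \<in> trace_reps"
        by (simp add: dual trace_reps_def)
    qed
  qed
qed

subsection \<open>The number of classes\<close>

lemma card_alg_classes: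
  fixes s t :: "'a::{field,finite}"
  assumes "(s, t) \<in> line_reps"
  defines "q \<equiv> CARD('a)"
    and "n \<equiv> card (range (\<lambda>p. algebra_iso_rel `` {alg (vector [s, 0]) (vector [t, 0]) p}))"
  shows "CHAR('a) \<noteq> 2 \<Longrightarrow> CHAR('a) \<noteq> 3 \<Longrightarrow> n = q^2 + 3 * q + 1"
    and "CHAR('a) = 2 \<Longrightarrow> n = q^2 + 3 * q"
    and "CHAR('a) = 3 \<Longrightarrow> n = (if s + t = 0 then q^2 + 4 * q else q^2 + 3 * q)"
proof -
  have "s \<noteq> 0 \<or> t \<noteq> 0" using assms(1) by (auto simp: line_reps_def)
  then have orb: "algebra_iso_rel `` {alg (vector [s, 0]) (vector [t, 0]) p} =
      algebra_iso_rel `` {alg (vector [s, 0]) (vector [t, 0]) p'} \<longleftrightarrow>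
      (\<exists>g\<in>UNIV \<times> - {0}. shift (s + t) g p' = p)" for p p'
    by (simp add: iso_class_eq_iff two_dim_algebra_alg alg_isomorphic_shift_iff del: shift.simps)
  show "CHAR('a) \<noteq> 2 \<Longrightarrow> CHAR('a) \<noteq> 3 \<Longrightarrow> n = q^2 + 3 * q + 1"
    and "CHAR('a) = 2 \<Longrightarrow> n = q^2 + 3 * q"
    and "CHAR('a) = 3 \<Longrightarrow> n = (if s + t = 0 then q^2 + 4 * q else q^2 + 3 * q)"
    unfolding n_def q_def by (rule card_shift_orbits[OF orb]; assumption)+
qed

text \<open>On the points (1 : t) the sum s + t runs once through the field; the remaining point (0
  : 1) gives the extra value 1.\<close>

lemma sum_line_reps:
  fixes h :: "'a::{field,finite} \<Rightarrow> nat"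
  shows "(\<Sum>(s, t)\<in>(line_reps :: ('a \<times> 'a) set). h (s + t)) = h 1 + (\<Sum>r\<in>UNIV. h r)"
proof -
  have "(\<Sum>(s, t)\<in>(line_reps :: ('a \<times> 'a) set). h (s + t)) = h 1 + (\<Sum>t\<in>UNIV. h (1 + t))"
    unfolding line_reps_def by (subst sum.insert) (auto simp: sum.reindex inj_on_def)
  also have "(\<Sum>t\<in>UNIV. h (1 + t)) = (\<Sum>r\<in>UNIV. h r)"
    by (rule sum.reindex_bij_betw[of "\<lambda>t. 1 + t"])
       (rule bij_betw_byWitness[where f' = "\<lambda>r. r - 1"]; auto)
  finally show ?thesis .
qed

lemma nonzero_trace_classes:
  "{m :: 'a::field^2 \<Rightarrow> 'a^2 \<Rightarrow> 'a^2. two_dim_algebra (*s) m \<and>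
      (tr1 (structure_matrix m) \<noteq> 0 \<or> tr2 (structure_matrix m) \<noteq> 0)} // algebra_iso_rel
   = (\<Union>(\<sigma>, \<tau>)\<in>trace_reps. range (\<lambda>p. algebra_iso_rel `` {alg \<sigma> \<tau> p}))" (is "?X // _ = ?R")
proof
  show "?X // algebra_iso_rel \<subseteq> ?R"
  proof
    fix C assume "C \<in> ?X // algebra_iso_rel"
    then obtain m where m: "two_dim_algebra (*s) m"
      "tr1 (structure_matrix m) \<noteq> 0 \<or> tr2 (structure_matrix m) \<noteq> 0"
      and C: "C = algebra_iso_rel `` {m}"
      by (auto simp: quotient_def)
    from nonzero_traces_representative[OF m] obtain \<sigma> \<tau> p where
      rep: "(\<sigma>, \<tau>) \<in> trace_reps" "algebra_isomorphic (*s) (alg \<sigma> \<tau> p) (*s) m" .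
    then have "C = algebra_iso_rel `` {alg \<sigma> \<tau> p}"
      using iso_class_eq_iff[OF two_dim_algebra_alg m(1)] C by blast
    then show "C \<in> ?R" using rep(1) by blast
  qed
  show "?R \<subseteq> ?X // algebra_iso_rel"
  proof clarify
    fix \<sigma> \<tau> :: "'a^2" and p assume "(\<sigma>, \<tau>) \<in> trace_reps"
    then have "\<sigma> \<noteq> 0 \<or> \<tau> \<noteq> 0"
      by (auto simp: trace_reps_def line_reps_def vec2_eq_iff)
    then have "alg \<sigma> \<tau> p \<in> ?X" by (simp add: two_dim_algebra_alg traces_alg)
    then show "algebra_iso_rel `` {alg \<sigma> \<tau> p} \<in> ?X // algebra_iso_rel" by (rule quotientI)
  qed
qed

text \<open>Families with different normalised traces share no class. In the independent family
  distinct parameters give distinct classes, which accounts for the q^4.\<close>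

lemma card_nonzero_trace_classes:
  "card ({m :: 'a::{field,finite}^2 \<Rightarrow> 'a^2 \<Rightarrow> 'a^2. two_dim_algebra (*s) m \<and>
      (tr1 (structure_matrix m) \<noteq> 0 \<or> tr2 (structure_matrix m) \<noteq> 0)} // algebra_iso_rel)
   = CARD('a)^4 + (\<Sum>(s, t)\<in>(line_reps :: ('a \<times> 'a) set).
       card (range (\<lambda>p. algebra_iso_rel `` {alg (vector [s, 0]) (vector [t, 0]) p})))"
proof -
  define K where "K = (\<lambda>(\<sigma> :: 'a^2, \<tau>). range (\<lambda>p. algebra_iso_rel `` {alg \<sigma> \<tau> p}))"
  define E where "E = (\<lambda>(s :: 'a, t :: 'a). (vector [s, 0] :: 'a^2, vector [t, 0] :: 'a^2))"
  have disjoint: "K i \<inter> K j = {}" if "i \<in> trace_reps" "j \<in> trace_reps" "i \<noteq> j" for i j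
  proof (rule ccontr)
    assume "K i \<inter> K j \<noteq> {}"
    then obtain p p' where "algebra_iso_rel `` {alg (fst i) (snd i) p} = algebra_iso_rel `` {alg (fst j) (snd j) p'}"
      by (auto simp: K_def split_beta)
    then have "algebra_isomorphic (*s) (alg (fst i) (snd i) p) (*s) (alg (fst j) (snd j) p')"
      by (simp add: iso_class_eq_iff two_dim_algebra_alg)
    from trace_reps_unique[OF _ _ this] that show False by (simp add: prod_eq_iff)
  qed
  have inj: "inj_on E line_reps"
    by (auto simp: inj_on_def E_def vec2_eq_iff)
  have reps: "trace_reps = insert (vector [1, 0], vector [0, 1]) (E ` line_reps)"
    by (simp add: trace_reps_def E_def)
  have "(vector [1, 0], vector [0, 1]) \<notin> E ` line_reps"
    by (auto simp: E_def vec2_eq_iff)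
  moreover have "card (K (vector [1, 0], vector [0, 1])) = CARD('a)^4"
  proof -
    have "inj (\<lambda>p. algebra_iso_rel `` {alg (vector [1, 0]) (vector [0, 1 :: 'a]) p})"
      by (simp add: inj_def iso_class_eq_iff two_dim_algebra_alg alg_isomorphic_dual_basis_iff)
    then show ?thesis by (simp add: K_def card_image power4_eq_xxxx)
  qed
  moreover have "card (\<Union>i\<in>trace_reps. K i) = (\<Sum>i\<in>trace_reps. card (K i))"
  proof (rule card_UN_disjoint)
    show "\<forall>i\<in>trace_reps. finite (K i)" by (auto simp: K_def)
  qed (use disjoint in auto)
  moreover have "finite (E ` line_reps)" by simp
  ultimately have "card (\<Union>i\<in>trace_reps. K i) = CARD('a)^4 + (\<Sum>i\<in>E ` line_reps. card (K i))"
    by (simp only: reps sum.insert not_False_eq_True)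
  also have "(\<Sum>i\<in>E ` line_reps. card (K i)) = (\<Sum>i\<in>line_reps. card (K (E i)))"
    using inj by (simp add: sum.reindex)
  finally have "card (\<Union>i\<in>trace_reps. K i) = CARD('a)^4 + (\<Sum>i\<in>line_reps. card (K (E i)))" .
  then show ?thesis
    unfolding nonzero_trace_classes by (simp add: K_def E_def split_beta)
qed

theorem theorem3p1:
  fixes q N :: nat
  assumes "q = CARD('a::{field,finite})"
    and "N = card ({m :: 'a^2 \<Rightarrow> 'a^2 \<Rightarrow> 'a^2. two_dim_algebra (*s) m \<and>
                      (tr1 (structure_matrix m) \<noteq> 0 \<or> tr2 (structure_matrix m) \<noteq> 0)}
                    // algebra_iso_rel)"
  shows "(CHAR('a) \<noteq> 2 \<and> CHAR('a) \<noteq> 3 \<longrightarrow> N = q^4 + q^3 + 4 * q^2 + 4 * q + 1) \<and>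
         (CHAR('a) = 3 \<longrightarrow> N = q^4 + q^3 + 4 * q^2 + 4 * q) \<and>
         (CHAR('a) = 2 \<longrightarrow> N = q^4 + q^3 + 4 * q^2 + 3 * q)"
proof -
  \<comment> \<open>Here \<open>h r\<close> is the number of classes over a point (s : t) with s + t
    = r.\<close>
  have N: "N = q^4 + (h 1 + (\<Sum>r\<in>UNIV. h r))"
    if "\<And>s t. (s, t) \<in> line_reps \<Longrightarrow>
      card (range (\<lambda>p. algebra_iso_rel `` {alg (vector [s, 0]) (vector [t, 0]) p})) = h (s + t)"
    for h :: "'a \<Rightarrow> nat"
    unfolding assms card_nonzero_trace_classes sum_line_reps[symmetric]
    by (intro arg_cong2[of _ _ _ _ "(+)"] refl sum.cong) (use that in auto)
  show ?thesis
  proof (intro conjI impI)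
    assume "CHAR('a) \<noteq> 2 \<and> CHAR('a) \<noteq> 3"
    then have "N = q^4 + ((q^2 + 3 * q + 1) + (\<Sum>r\<in>(UNIV :: 'a set). q^2 + 3 * q + 1))"
      by (intro N) (simp add: card_alg_classes assms(1))
    then show "N = q^4 + q^3 + 4 * q^2 + 4 * q + 1"
      by (simp add: assms(1)[symmetric] algebra_simps power2_eq_square power3_eq_cube)
  next
    assume "CHAR('a) = 2"
    then have "N = q^4 + ((q^2 + 3 * q) + (\<Sum>r\<in>(UNIV :: 'a set). q^2 + 3 * q))"
      by (intro N) (simp add: card_alg_classes assms(1))
    then show "N = q^4 + q^3 + 4 * q^2 + 3 * q"
      by (simp add: assms(1)[symmetric] algebra_simps power2_eq_square power3_eq_cube)
  next
    assume c: "CHAR('a) = 3"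
    \<comment> \<open>The surplus q of the case s + t = 0 enters the sum over r exactly once and
      does not affect \<open>h 1\<close>.\<close>
    define h where "h = (\<lambda>r::'a. q^2 + 3 * q + (if r = 0 then q else 0))"
    have "N = q^4 + (h 1 + (\<Sum>r\<in>UNIV. h r))"
      by (intro N) (simp add: c card_alg_classes assms(1) h_def)
    also have "(\<Sum>r\<in>UNIV. h r) = q * (q^2 + 3 * q) + q"
      by (simp add: h_def sum.distrib assms(1)[symmetric])
    finally show "N = q^4 + q^3 + 4 * q^2 + 4 * q"
      by (simp add: h_def algebra_simps power2_eq_square power3_eq_cube)
  qed
qed

end
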